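(* Let $\mathcal{A}$ be a finite alphabet and let $\mathbf{u}$ be an infinite word over $\mathcal{A}$. Assume that each factor of $\mathbf{u}$ occurs in $\mathbf{u}$ with a uniform frequency and that $\mathbf{u}$ avoids abelian $k_0$-powers for some $k_0>0$. Then there exists a finite coloring $c$ of $\mathcal{L}(\mathbf{u})$ which avoids arbitrarily large monochromatic $k$-powers with uniformly bounded gaps. That is, there exist $r\ge 1$ and $c:\mathcal{L}(\mathbf{u})\to\{1,\ldots,r\}$ such that for every $p>0$ there is an integer $k_1$ such that for all $k\ge k_1$ no word in $\mathcal{L}(\mathbf{u})$ is a monochromatic $k$-power with gaps bounded by $p$ with respect to $c$.
   Context: For a finite word $\mathbf{w}$ over $\mathcal{A}$, $|\mathbf{w}|$ denotes its length. For an infinite word $\mathbf{u}=\alpha_1\alpha_2\ldots$, $\mathbf{u}_{[i,j]}=\alpha_i\ldots\alpha_j$ for $1\le i\le j$, and $\mathcal{L}(\mathbf{u})$ is the set of all nonempty finite factors of $\mathbf{u}$. Uniform frequency: a factor $\mathbf{w}\in\mathcal{L}(\mathbf{u})$ occurs in $\mathbf{u}$ with a uniform frequency if, writing $L_{\mathbf{w}}(\mathbf{u}_{I})$ for the number of occurrences of $\mathbf{w}$ in $\mathbf{u}_I$, the quantity $L_{\mathbf{w}}(\mathbf{u}_{[k,k+N]})/N$ converges, as $N\to\infty$, uniformly in $k$ to some number $d_{\mathbf{w}}\ge 0$. Abelian powers: a word $\mathbf{w}=\mathbf{w}_1\mathbf{w}_2\ldots\mathbf{w}_k$, with the $\mathbf{w}_i$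 nonempty finite words, is an abelian $k$-power if any two of the factors $\mathbf{w}_i$ are permutations of each other (each letter occurs the same number of times in both). The word $\mathbf{u}$ avoids abelian $k_0$-powers if no element of $\mathcal{L}(\mathbf{u})$ is an abelian $k_0$-power. Monochromatic powers: given a coloring $c:\mathcal{L}(\mathbf{u})\to\{1,\ldots,r\}$, a word $\mathbf{w}\in\mathcal{L}(\mathbf{u})$ is a monochromatic $k$-power with gaps bounded by $p$ if there is a factorization $\mathbf{w}=\mathbf{w}_1\mathbf{w}_2\ldots\mathbf{w}_k$ with $\mathbf{w}_i\in\mathcal{L}(\mathbf{u})$, $c(\mathbf{w}_i)=c(\mathbf{w}_j)$ for all $i,j$, and $|\mathbf{w}_i|<p$ for all $i$. *)

theory Defs
  imports
    "HOL-Analysis.Uniform_Limit"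
    "HOL-Library.FuncSet"
    "HOL-Library.Multiset"
    "HOL-Library.Omega_Words_Fun"
begin

text \<open>
  Infinite words have type \<open>nat \<Rightarrow> 'a\<close>, with \<open>u 0\<close>, \<open>u 1\<close>, \dots representing
  the letters numbered 1, 2, \dots.  The factor from position \<open>i\<close> to position \<open>j\<close>
  (both inclusive, counted from 1) is thus the half-open block from \<open>i - 1\<close> to \<open>j\<close>.
\<close>

definition segment :: "'a word \<Rightarrow> nat \<Rightarrow> nat \<Rightarrow> 'a list" where
  "segment u i j = subsequence u (i - 1) j"

definition language :: "'a word \<Rightarrow> 'a list set" where
  "language u = {segment u i j | i j. 1 \<le> i \<and> i \<le> j}"

text \<open>Occurrences are counted by their starting positions, so they may overlap.\<close>

definition occurrences :: "'a list \<Rightarrow> 'a list \<Rightarrow> nat" where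
  "occurrences w v = card {i. i + length w \<le> length v \<and> take (length w) (drop i v) = w}"

definition has_uniform_frequency :: "'a word \<Rightarrow> 'a list \<Rightarrow> bool" where
  "has_uniform_frequency u w \<longleftrightarrow>
    (\<exists>d\<ge>0. uniform_limit {1..}
      (\<lambda>N k. real (occurrences w (segment u k (k + N))) / real N) (\<lambda>k. d) sequentially)"

definition abelian_power :: "nat \<Rightarrow> 'a list \<Rightarrow> bool" where
  "abelian_power k w \<longleftrightarrow>
    (\<exists>ws. length ws = k \<and> w = concat ws \<and> (\<forall>v\<in>set ws. v \<noteq> []) \<and>
      (\<forall>v\<in>set ws. \<forall>v'\<in>set ws. mset v = mset v'))"

definition avoids_abelian_powers :: "'a word \<Rightarrow> nat \<Rightarrow> bool" where
  "avoids_abelian_powers u k \<longleftrightarrow> (\<forall>w\<in>language u. \<not> abelian_power k w)"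

text \<open>A coloring is a function on all lists; only its values on \<open>language u\<close> are used.\<close>

definition monochromatic_power ::
  "'a word \<Rightarrow> ('a list \<Rightarrow> nat) \<Rightarrow> nat \<Rightarrow> nat \<Rightarrow> 'a list \<Rightarrow> bool" where
  "monochromatic_power u c k p w \<longleftrightarrow>
    w \<in> language u \<and>
    (\<exists>ws. length ws = k \<and> w = concat ws \<and> set ws \<subseteq> language u \<and>
      (\<forall>v\<in>set ws. \<forall>v'\<in>set ws. c v = c v') \<and> (\<forall>v\<in>set ws. length v < p))"

end

theory Submission
  imports Defs
begin

text \<open>
  Color a factor by the signs of its discrepancies \<open>count v a - d a * |v|\<close>, where \<open>d a\<close> is the
  frequency of the letter \<open>a\<close>. In a monochromatic power with bounded gaps a nonzero discrepancy
  adds up linearly in the number of blocks, which uniform frequency forbids if there are many blocks.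
  So all blocks of a long monochromatic power have Parikh vectors proportional to their lengths.
  The block boundaries are syndetic, so by van der Waerden's theorem they contain a
  \<open>(k0 + 1)\<close>-term arithmetic progression, and this delimits an abelian \<open>k0\<close>-power.
\<close>

section \<open>Van der Waerden's theorem\<close>

text \<open>The point \<open>a + k * d\<close> just after the progression is required to lie below \<open>N\<close> as well:
  it is the focus in the color focusing argument.\<close>

definition mono_progression :: "(nat \<Rightarrow> nat) \<Rightarrow> nat \<Rightarrow> nat \<Rightarrow> bool" where
  "mono_progression c k N \<longleftrightarrow>
    (\<exists>a d. d > 0 \<and> a + k * d < N \<and> (\<forall>i<k. c (a + i * d) = c a))"

text \<open>The monochromatic progressions, one for each color in \<open>G\<close>, share the next
  point \<open>f\<close>. If the color of \<open>f\<close> lies in \<open>G\<close>, it lengthens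
  one of them.\<close>

definition color_focused :: "(nat \<Rightarrow> nat) \<Rightarrow> nat \<Rightarrow> nat \<Rightarrow> nat set \<Rightarrow> nat \<Rightarrow> bool" where
  "color_focused c k f G N \<longleftrightarrow>
    f < N \<and> (\<forall>g\<in>G. \<exists>a d. d > 0 \<and> a + k * d = f \<and> (\<forall>i<k. c (a + i * d) = g))"

lemma mono_progression_mono: "mono_progression c k N \<Longrightarrow> N \<le> M \<Longrightarrow> mono_progression c k M"
  unfolding mono_progression_def by (meson order_less_le_trans)

lemma mono_progression_shift:
  assumes "mono_progression (\<lambda>x. c (x + y)) k N" and "y + N \<le> M"
  shows "mono_progression c k M"
proof -
  obtain a d where *: "d > 0" "a + k * d < N" "\<forall>i<k. c (a + i * d + y) = c (a + y)"
    using assms(1) unfolding mono_progression_def by blast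
  then show ?thesis
    unfolding mono_progression_def using assms(2)
    by (intro exI[of _ "a + y"] exI[of _ d]) (auto simp: ac_simps)
qed

text \<open>The former focus becomes the last term, so the new focus lies \<open>d\<close> further
  on. As \<open>k \<ge> 1\<close>, \<open>d \<le> k * d < N\<close>, and doubling the bound makes
  room for it.\<close>

lemma mono_progression_extend:
  assumes "k \<ge> 1" "d > 0" "a + k * d < N" "\<forall>i\<le>k. c (a + i * d) = g"
  shows "mono_progression c (Suc k) (2 * N)"
proof -
  have "d \<le> k * d" using assms(1) by simp
  then have "a + Suc k * d < 2 * N" using assms(3) unfolding mult_Suc by linarith
  moreover have "c a = g" using assms(4)[rule_format, of 0] by simp
  ultimately show ?thesis
    unfolding mono_progression_def using assms
    by (intro exI[of _ a] exI[of _ d]) auto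
qed

text \<open>Induction on the number \<open>s\<close> of focused colors. Applying \<open>vdW\<close>
  to the contents of windows of length \<open>n\<close> yields \<open>k\<close> equal windows at
  distance \<open>D\<close>. The focus of the first window contributes a new color, and the old
  progressions are tilted towards a common new focus. \<open>vdW\<close> ranges over all finite
  color sets because window contents form a color set of their own.\<close>

lemma color_focusing:
  assumes "k \<ge> 1" and "finite F"
    and vdW: "\<And>F. finite F \<Longrightarrow> \<exists>N. \<forall>c. range c \<subseteq> F \<longrightarrow> mono_progression c k N"
    and "s \<le> card F"
  shows "\<exists>N. \<forall>c. range c \<subseteq> F \<longrightarrow> mono_progression c (Suc k) N \<or>
    (\<exists>G f. G \<subseteq> F \<and> card G = s \<and> color_focused c k f G N)"
  using assms(4)
proof (induction s)
  case 0
  show ?case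
    by (rule exI[of _ 1]) (auto intro!: exI[of _ "{}"] exI[of _ 0] simp: color_focused_def)
next
  case (Suc s)
  then obtain n where n: "\<And>c. range c \<subseteq> F \<Longrightarrow> mono_progression c (Suc k) n \<or>
    (\<exists>G f. G \<subseteq> F \<and> card G = s \<and> color_focused c k f G n)"
    by (metis Suc_leD)
  \<comment> \<open>Colors are natural numbers, so window contents, being lists, are encoded by
    \<open>to_nat\<close>.\<close>
  define F' where "F' = to_nat ` {xs. set xs \<subseteq> F \<and> length xs = n}"
  have "finite F'"
    unfolding F'_def by (intro finite_imageI finite_lists_length_eq assms)
  then obtain M where M: "\<And>c. range c \<subseteq> F' \<Longrightarrow> mono_progression c k M"
    using vdW by meson
  show ?case
  \<comment> \<open>\<open>n + M\<close> covers an offset below \<open>n\<close> inside a window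
    that starts below \<open>M\<close>; the factor 2 comes from
    \<open>mono_progression_extend\<close>.\<close>
  proof (intro exI[of _ "2 * (n + M)"] allI impI)
    fix c :: "nat \<Rightarrow> nat" assume c: "range c \<subseteq> F"
    define w where "w x = map (\<lambda>y. c (x + y)) [0..<n]" for x
    have "range (\<lambda>x. to_nat (w x)) \<subseteq> F'"
      unfolding F'_def w_def by (intro image_subsetI imageI) (use c in auto)
    from M[OF this] obtain x D where xD: "D > 0" "x + k * D < M" "\<And>i. i < k \<Longrightarrow> w (x + i * D) = w x"
      unfolding mono_progression_def by auto
    have win: "c (x + i * D + y) = c (x + y)" if "i < k" "y < n" for i y
    proof -
      have "w (x + i * D) ! y = w x ! y" using xD(3)[OF that(1)] by simp
      then show ?thesis using that(2) by (simp add: w_def)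
    qed
    have "range (\<lambda>y. c (y + x)) \<subseteq> F" using c by auto
    from n[OF this] show "mono_progression c (Suc k) (2 * (n + M)) \<or>
      (\<exists>G f. G \<subseteq> F \<and> card G = Suc s \<and> color_focused c k f G (2 * (n + M)))"
    proof (elim disjE exE conjE)
      assume "mono_progression (\<lambda>y. c (y + x)) (Suc k) n"
      then have "mono_progression c (Suc k) (2 * (n + M))"
        by (rule mono_progression_shift) (use xD in simp)
      then show ?thesis ..
    next
      fix G f
      assume G: "G \<subseteq> F" "card G = s" and foc: "color_focused (\<lambda>y. c (y + x)) k f G n"
      have f: "f < n" using foc by (simp add: color_focused_def)
      show ?thesis
      proof (cases "c (f + x) \<in> G")
        case True
        then obtain a d where ad: "d > 0" "a + k * d = f" "\<forall>i<k. c (a + i * d + x) = c (f + x)"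
          using foc unfolding color_focused_def by blast
        have "\<forall>i\<le>k. c (a + x + i * d) = c (f + x)"
          using ad by (auto simp: le_less ac_simps)
        moreover have "a + x + k * d < n + M" using ad f xD by simp
        ultimately show ?thesis
          using mono_progression_extend[OF assms(1) ad(1)] by blast
      next
        case False
        let ?G = "insert (c (f + x)) G"
        have "finite G" using G(1) assms(2) finite_subset by blast
        then have "card ?G = Suc s" using False G(2) by simp
        moreover have "?G \<subseteq> F" using G(1) c by auto
        moreover have "color_focused c k (f + x + k * D) ?G (2 * (n + M))"
          unfolding color_focused_def
        proof (intro conjI ballI)
          show "f + x + k * D < 2 * (n + M)" using f xD by simp
        next
          fix g assume "g \<in> ?G"
          then consider "g = c (f + x)" | "g \<in> G" by blast
          then show "\<exists>a d. 0 < d \<and> a + k * d = f + x + k * D \<and> (\<forall>i<k. c (a + i * d) = g)"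
          proof cases
            \<comment> \<open>The copies of \<open>f\<close> in the \<open>k\<close> equal windows
              form a progression with step \<open>D\<close>.\<close>
            case 1
            then show ?thesis
              using win[of _ f] f xD(1)
              by (intro exI[of _ "f + x"] exI[of _ D]) (auto simp: ac_simps)
          next
            case 2
            then obtain a d where ad: "d > 0" "a + k * d = f" "\<forall>i<k. c (a + i * d + x) = g"
              using foc unfolding color_focused_def by blast
            \<comment> \<open>Tilting: term \<open>i\<close> is taken from window \<open>i\<close>,
              so the step becomes \<open>d + D\<close>. The color survives because
              \<open>a + i * d \<le> f < n\<close> stays inside the window.\<close>
            have "c (a + x + i * (d + D)) = g" if "i < k" for i
            proof -
              have "i * d \<le> k * d" using that by simp
              then have "a + i * d < n" using ad(2) f by linarith
              from win[OF that this] show ?thesis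
                using ad(3)[rule_format, OF that] by (simp add: algebra_simps)
            qed
            moreover have "a + x + k * (d + D) = f + x + k * D"
              using ad(2) by (simp add: algebra_simps)
            ultimately show ?thesis
              using ad(1) by (intro exI[of _ "a + x"] exI[of _ "d + D"]) auto
          qed
        qed
        ultimately show ?thesis by blast
      qed
    qed
  qed
qed

text \<open>Once \<open>card F\<close> colors are focused they exhaust \<open>F\<close>, so the
  color of the focus is among them and one progression gains a term.\<close>

theorem van_der_Waerden:
  "finite F \<Longrightarrow> \<exists>N. \<forall>c. range c \<subseteq> F \<longrightarrow> mono_progression c k N"
proof (induction k arbitrary: F)
  case 0
  show ?case by (rule exI[of _ 1]) (auto simp: mono_progression_def)
next
  case (Suc k)
  show ?case
  proof (cases "k = 0")
    case True
    have "mono_progression c 1 2" for c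
      unfolding mono_progression_def by (rule exI[of _ 0], rule exI[of _ 1]) simp
    then show ?thesis using True by auto
  next
    case False
    then have k: "k \<ge> 1" by simp
    obtain N where N: "\<And>c. range c \<subseteq> F \<Longrightarrow> mono_progression c (Suc k) N \<or>
      (\<exists>G f. G \<subseteq> F \<and> card G = card F \<and> color_focused c k f G N)"
      using color_focusing[OF k Suc.prems Suc.IH order_refl] by auto
    show ?thesis
    proof (intro exI[of _ "2 * N"] allI impI)
      fix c :: "nat \<Rightarrow> nat" assume c: "range c \<subseteq> F"
      from N[OF c] show "mono_progression c (Suc k) (2 * N)"
      proof (elim disjE exE conjE)
        assume "mono_progression c (Suc k) N"
        then show ?thesis by (rule mono_progression_mono) simp
      next
        fix G f assume "G \<subseteq> F" "card G = card F" and foc: "color_focused c k f G N"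
        then have "G = F" using Suc.prems card_subset_eq by blast
        then have "c f \<in> G" using c by auto
        then obtain a d where ad: "d > 0" "a + k * d = f" "\<forall>i<k. c (a + i * d) = c f" and f: "f < N"
          using foc unfolding color_focused_def by blast
        have "\<forall>i\<le>k. c (a + i * d) = c f" using ad by (auto simp: le_less)
        then show ?thesis using mono_progression_extend[OF k ad(1)] ad(2) f by blast
      qed
    qed
  qed
qed

text \<open>Each \<open>x < T k\<close> is colored by its distance to a preceding cut point.\<close>

lemma progression_in_cut_points:
  fixes p m :: nat
  shows "\<exists>K. \<forall>T k. K \<le> k \<and> T 0 = (0::nat) \<and> (\<forall>j<k. T j < T (Suc j) \<and> T (Suc j) < T j + p)
    \<longrightarrow> (\<exists>a d. d > 0 \<and> (\<forall>i\<le>m. \<exists>j\<le>k. a + i * d = T j))"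
proof -
  obtain N where N: "\<And>c. range c \<subseteq> {..p} \<Longrightarrow> mono_progression c (Suc m) N"
    using van_der_Waerden[of "{..p}" "Suc m"] by auto
  show ?thesis
  \<comment> \<open>Cut points increase strictly from 0, so \<open>T k \<ge> k \<ge> N\<close> and
    every point below \<open>N\<close> lies before the last cut point.\<close>
  proof (rule exI[of _ N], intro allI impI, elim conjE)
    fix T :: "nat \<Rightarrow> nat" and k
    assume k: "N \<le> k" and T0: "T 0 = 0"
      and "\<forall>j<k. T j < T (Suc j) \<and> T (Suc j) < T j + p"
    then have T: "\<And>j. j < k \<Longrightarrow> T j < T (Suc j) \<and> T (Suc j) < T j + p" by blast
    have ge: "j \<le> k \<Longrightarrow> j \<le> T j" for j
      by (induction j) (use T in \<open>auto simp: Suc_le_eq intro: le_less_trans\<close>)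
    have "n \<le> k \<Longrightarrow> x < T n \<Longrightarrow> \<exists>e\<le>p. \<exists>j\<le>k. x = T j + e" for n x
    proof (induction n)
      case (Suc n)
      show ?case
      proof (cases "x < T n")
        case False
        then show ?thesis
          using T[of n] Suc.prems by (intro exI[of _ "x - T n"] conjI exI[of _ n]) auto
      qed (use Suc in simp)
    qed (simp add: T0)
    \<comment> \<open>The bound \<open>e \<le> p\<close> is kept beyond \<open>T k\<close> as well,
      so that the choice gives a total coloring with finite range.\<close>
    then have "\<forall>x. \<exists>e. e \<le> p \<and> (x < T k \<longrightarrow> (\<exists>j\<le>k. x = T j + e))"
      by (metis order_refl)
    then obtain c where c: "\<And>x. c x \<le> p" "\<And>x. x < T k \<Longrightarrow> \<exists>j\<le>k. x = T j + c x"
      by metis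
    have "range c \<subseteq> {..p}" using c(1) by auto
    from N[OF this] obtain a d where ad: "d > 0" "a + Suc m * d < N" "\<And>i. i \<le> m \<Longrightarrow> c (a + i * d) = c a"
      unfolding mono_progression_def by (auto simp: less_Suc_eq_le)
    have cut: "\<exists>j\<le>k. a + i * d = T j + c a" if "i \<le> m" for i
    proof -
      have "i * d \<le> Suc m * d" using that by (intro mult_le_mono1) simp
      then have "a + i * d < T k" using ad(2) k ge[of k] by linarith
      then show ?thesis using c(2) ad(3)[OF that] by metis
    qed
    \<comment> \<open>All terms have the same offset \<open>c a\<close> from a cut point, so
      subtracting it moves the whole progression onto cut points. Term 0 ensures that this
      subtraction is not truncated.\<close>
    have "c a \<le> a" using cut[of 0] by auto
    then have "\<forall>i\<le>m. \<exists>j\<le>k. a - c a + i * d = T j"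
      using cut by (metis Nat.add_diff_assoc2 diff_add_inverse2)
    then show "\<exists>a d. d > 0 \<and> (\<forall>i\<le>m. \<exists>j\<le>k. a + i * d = T j)"
      using ad(1) by blast
  qed
qed

section \<open>Factors and letter counts\<close>

lemma language_eq: "language u = {map u [i..<j] | i j. i < j}"
proof (intro set_eqI iffI)
  fix w assume "w \<in> language u"
  then obtain i j where "1 \<le> i" "i \<le> j" "w = map u [i - 1..<j]"
    by (auto simp: language_def segment_def subsequence_def)
  then show "w \<in> {map u [i..<j] | i j. i < j}" by force
next
  fix w assume "w \<in> {map u [i..<j] | i j. i < j}"
  then obtain i j where "i < j" "w = map u [i..<j]" by blast
  then have "w = segment u (Suc i) j" "1 \<le> Suc i" "Suc i \<le> j"
    by (auto simp: segment_def subsequence_def)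
  then show "w \<in> language u" unfolding language_def by blast
qed

lemma occurrences_singleton: "occurrences [a] v = count (mset v) a"
proof -
  have "{i. i + length [a] \<le> length v \<and> take (length [a]) (drop i v) = [a]}
      = {i. i < length v \<and> v ! i = a}"
    by (auto simp: Suc_le_eq take_Suc_conv_app_nth)
  then show ?thesis
    by (simp add: occurrences_def count_mset count_list_eq_length_filter length_filter_conv_card eq_commute)
qed

section \<open>Discrepancies of letters and uniform frequency\<close>

definition discrepancy :: "('a \<Rightarrow> real) \<Rightarrow> 'a \<Rightarrow> 'a list \<Rightarrow> real" where
  "discrepancy d a v = real (count (mset v) a) - d a * real (length v)"

lemma discrepancy_concat: "discrepancy d a (concat vs) = (\<Sum>v\<leftarrow>vs. discrepancy d a v)"
  by (induction vs) (auto simp: discrepancy_def algebra_simps)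

lemma discrepancy_append: "discrepancy d a (v @ w) = discrepancy d a v + discrepancy d a w"
  by (simp add: discrepancy_def algebra_simps)

lemma length_concat_ge: "(\<And>v. v \<in> set vs \<Longrightarrow> v \<noteq> []) \<Longrightarrow> length vs \<le> length (concat vs)"
proof (induction vs)
  case (Cons v vs)
  then have "length v \<ge> 1" by (simp add: Suc_le_eq)
  with Cons show ?case by fastforce
qed simp

text \<open>Equal signs exclude cancellation: multiplying by the common sign turns the sum into the
  sum of the absolute values.\<close>

lemma abs_sum_list_same_sgn:
  fixes xs :: "real list"
  assumes "\<And>x. x \<in> set xs \<Longrightarrow> sgn x = s" and "\<And>x. x \<in> set xs \<Longrightarrow> e \<le> \<bar>x\<bar>"
  shows "e * length xs \<le> \<bar>sum_list xs\<bar>"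
proof -
  have "s * sum_list xs = sum_list (map abs xs)"
    using assms(1) by (induction xs) (auto simp: algebra_simps abs_sgn)
  moreover have "e * length xs \<le> sum_list (map abs xs)"
    using assms(2) by (induction xs) (auto simp: algebra_simps add_mono)
  moreover have "s * sum_list xs \<le> \<bar>sum_list xs\<bar>"
  \<comment> \<open>The empty list leaves \<open>s\<close> unconstrained, but its sum is 0;
    otherwise \<open>s\<close> is -1, 0 or 1.\<close>
  proof (cases xs)
    case (Cons x ys)
    then have "s = sgn x" using assms(1) by simp
    then show ?thesis by (auto simp: sgn_real_def)
  qed simp
  ultimately show ?thesis by linarith
qed

text \<open>Uniform frequency divides by \<open>N\<close> on segments of length
  \<open>N + 1\<close>; the bound is relative to the true length. Uniformity in the starting
  position lets one \<open>L\<close> serve all factors.\<close>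

lemma discrepancy_uniform_bound:
  assumes "has_uniform_frequency u [a]"
  obtains d where "\<And>e. e > 0 \<Longrightarrow> \<exists>L. \<forall>v\<in>language u. length v \<ge> L \<longrightarrow>
    \<bar>real (count (mset v) a) - d * real (length v)\<bar> \<le> e * real (length v)"
proof -
  obtain d where "d \<ge> 0" and d: "uniform_limit {1..}
      (\<lambda>N k. real (occurrences [a] (segment u k (k + N))) / real N) (\<lambda>k. d) sequentially"
    using assms unfolding has_uniform_frequency_def by blast
  have "\<exists>L. \<forall>v\<in>language u. length v \<ge> L \<longrightarrow>
    \<bar>real (count (mset v) a) - d * real (length v)\<bar> \<le> e * real (length v)" if "e > 0" for e
  proof -
    have "eventually (\<lambda>N. \<forall>k\<in>{1..}.
        dist (real (occurrences [a] (segment u k (k + N))) / real N) d < e / 2) sequentially"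
      using d[unfolded uniform_limit_iff, rule_format, of "e / 2"] that by simp
    then obtain N0 where N0: "\<And>N k. N \<ge> N0 \<Longrightarrow> k \<ge> 1 \<Longrightarrow>
        \<bar>real (occurrences [a] (segment u k (k + N))) / real N - d\<bar> < e / 2"
      unfolding eventually_sequentially dist_real_def by auto
    \<comment> \<open>With \<open>N = length v - 1\<close>, the part \<open>N0 + 2\<close> gives
      \<open>N \<ge> N0\<close> and \<open>N > 0\<close>. The last summand makes the error
      \<open>d\<close> caused by the extra letter at most \<open>e / 2 * length v\<close>.\<close>
    define L where "L = N0 + 2 + nat \<lceil>2 * d / e\<rceil>"
    show ?thesis
    proof (intro exI[of _ L] ballI impI)
      fix v assume v: "v \<in> language u" "L \<le> length v"
      then obtain k j where kj: "1 \<le> k" "k \<le> j" "v = segment u k j"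
        unfolding language_def by blast
      define N where "N = j - k"
      have vN: "v = segment u k (k + N)" "length v = N + 1"
        using kj by (auto simp: N_def segment_def subsequence_def)
      have N: "N \<ge> N0" "N > 0" using v vN by (auto simp: L_def)
      have "\<bar>real (count (mset v) a) / real N - d\<bar> < e / 2"
        using N0[OF N(1) kj(1)] by (simp add: vN(1)[symmetric] occurrences_singleton)
      then have "\<bar>real (count (mset v) a) / real N - d\<bar> * N < e / 2 * N"
        using N(2) by (intro mult_strict_right_mono) auto
      moreover have "\<bar>real (count (mset v) a) / real N - d\<bar> * N = \<bar>real (count (mset v) a) - d * N\<bar>"
        using N(2) by (simp add: abs_mult_pos left_diff_distrib)
      ultimately have N_close: "\<bar>real (count (mset v) a) - d * N\<bar> < e / 2 * N"
        by simp
      have d_le: "d \<le> e / 2 * length v"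
      proof -
        have "2 * d / e \<le> length v" using v(2) by (simp add: L_def) linarith
        then show ?thesis using that by (simp add: field_simps)
      qed
      have "\<bar>real (count (mset v) a) - d * length v\<bar> \<le> \<bar>real (count (mset v) a) - d * N\<bar> + d"
      proof -
        have "real (count (mset v) a) - d * length v = (real (count (mset v) a) - d * N) - d"
          by (simp add: vN(2) algebra_simps)
        then show ?thesis using \<open>d \<ge> 0\<close> by (simp only:)
      qed
      also have "\<dots> \<le> e / 2 * N + e / 2 * length v"
        using N_close d_le by (intro add_mono) simp_all
      also have "\<dots> \<le> e * length v"
        using that by (simp add: vN(2) field_simps)
      finally show "\<bar>real (count (mset v) a) - d * real (length v)\<bar> \<le> e * real (length v)" .
    qed
  qed
  then show ?thesis using that by blast
qed

text \<open>Blocks shorter than \<open>p\<close> have finitely many possible discrepancies, so the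
  nonzero ones are at least some \<open>e > 0\<close> in absolute value. With equal signs they add
  up to at least \<open>e\<close> per block, whereas \<open>bound\<close> allows a long
  concatenation only half of that.\<close>

lemma discrepancy_vanishes:
  assumes bound: "\<And>e. e > 0 \<Longrightarrow> \<exists>L. \<forall>v\<in>language u. length v \<ge> L \<longrightarrow>
    \<bar>discrepancy d a v\<bar> \<le> e * real (length v)"
  shows "\<exists>K. \<forall>ws. length ws \<ge> K \<and> concat ws \<in> language u \<and>
    (\<forall>v\<in>set ws. v \<noteq> [] \<and> length v < p) \<and>
    (\<forall>v\<in>set ws. \<forall>v'\<in>set ws. sgn (discrepancy d a v) = sgn (discrepancy d a v')) \<longrightarrow>
    (\<forall>v\<in>set ws. discrepancy d a v = 0)"
proof -
  \<comment> \<open>The element 1 keeps \<open>E\<close> nonempty even if every discrepancy on the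
    grid is 0.\<close>
  define E where "E = insert 1 ((\<lambda>(m, n). \<bar>real m - d a * real n\<bar>) ` ({..p} \<times> {..p}) - {0})"
  define e where "e = Min E"
  have "finite E" by (simp add: E_def)
  moreover have "\<forall>x\<in>E. x > 0" by (auto simp: E_def)
  ultimately have e: "e > 0" unfolding e_def by (subst Min_gr_iff) (auto simp: E_def)
  have e_le: "e \<le> \<bar>discrepancy d a v\<bar>" if "length v < p" "discrepancy d a v \<noteq> 0" for v
  proof -
    have "count (mset v) a \<le> p"
      using that(1) count_le_length[of v a] by (simp add: count_mset)
    then have "\<bar>discrepancy d a v\<bar> \<in> E"
      using that unfolding E_def discrepancy_def
      by (auto intro!: image_eqI[of _ _ "(count (mset v) a, length v)"])
    then show ?thesis unfolding e_def using \<open>finite E\<close> by simp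
  qed
  \<comment> \<open>The total length is at most \<open>p + 1\<close> per block, so this slope allows
    at most \<open>e / 2\<close> per block; \<open>p + 1\<close> also avoids division by zero when
    \<open>p = 0\<close>.\<close>
  obtain L where L: "\<And>v. v \<in> language u \<Longrightarrow> length v \<ge> L \<Longrightarrow>
      \<bar>discrepancy d a v\<bar> \<le> e / (2 * (real p + 1)) * real (length v)"
    using bound[of "e / (2 * (real p + 1))"] e by auto
  show ?thesis
  proof (intro exI[of _ "L + 1"] allI impI ballI, elim conjE, rule ccontr)
    fix ws v
    assume len: "length ws \<ge> L + 1" and lang: "concat ws \<in> language u"
      and ws: "\<forall>v\<in>set ws. v \<noteq> [] \<and> length v < p"
      and sg: "\<forall>v\<in>set ws. \<forall>v'\<in>set ws. sgn (discrepancy d a v) = sgn (discrepancy d a v')"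
      and v: "v \<in> set ws" and nz: "discrepancy d a v \<noteq> 0"
    let ?l = "length (concat ws)"
    have "e * length (map (discrepancy d a) ws) \<le> \<bar>sum_list (map (discrepancy d a) ws)\<bar>"
    proof (rule abs_sum_list_same_sgn[where s = "sgn (discrepancy d a v)"])
      fix x assume "x \<in> set (map (discrepancy d a) ws)"
      then obtain v' where v': "v' \<in> set ws" "x = discrepancy d a v'" by auto
      then show sgn: "sgn x = sgn (discrepancy d a v)" using sg v by blast
      have "x \<noteq> 0"
      proof
        assume "x = 0"
        then have "sgn (discrepancy d a v) = 0" using sgn by simp
        then show False using nz by (simp only: sgn_zero_iff)
      qed
      then show "e \<le> \<bar>x\<bar>" using e_le[of v'] ws v' by blast
    qed
    then have "e * length ws \<le> \<bar>discrepancy d a (concat ws)\<bar>"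
      by (simp add: discrepancy_concat)
    also have "\<dots> \<le> e / (2 * (real p + 1)) * ?l"
    proof (rule L[OF lang])
      have "length ws \<le> ?l"
        using length_concat_ge ws by blast
      then show "L \<le> ?l" using len by simp
    qed
    also have "\<dots> \<le> e / (2 * (real p + 1)) * (length ws * (real p + 1))"
    proof (intro mult_left_mono)
      have "?l \<le> length ws * (p + 1)" using ws by (induction ws) auto
      then show "real ?l \<le> length ws * (real p + 1)"
        by (metis of_nat_1 of_nat_add of_nat_le_iff of_nat_mult)
    qed (use e in simp)
    also have "\<dots> = e * length ws / 2" by (simp add: field_simps)
    finally show False using e len by (simp add: field_simps)
  qed
qed

text \<open>By additivity, the stretch between two consecutive prefixes of zero discrepancy has zero
  discrepancy too. It has length \<open>n\<close>, so it contains each letter \<open>a\<close> of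
  \<open>u\<close> exactly \<open>d a * n\<close> times, whichever stretch it is.\<close>

lemma abelian_power_in_language:
  assumes freq: "\<And>a i. a \<in> range u \<Longrightarrow> i \<le> k \<Longrightarrow> discrepancy d a (map u [s..<s + (x + i * n)]) = 0"
    and "n > 0" "k > 0"
  shows "\<not> avoids_abelian_powers u k"
proof -
  define block where "block i = map u [s + (x + i * n)..<s + (x + Suc i * n)]" for i
  have disc: "discrepancy d a (block i) = 0" if "a \<in> range u" "i < k" for a i
  proof -
    have "[s..<s + (x + Suc i * n)] = [s..<s + (x + i * n)] @ [s + (x + i * n)..<s + (x + Suc i * n)]"
      using upt_add_eq_append[of s "s + (x + i * n)" n] by (simp add: algebra_simps)
    then have "map u [s..<s + (x + Suc i * n)] = map u [s..<s + (x + i * n)] @ block i"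
      by (simp add: block_def)
    then show ?thesis
      using freq[of a i] freq[of a "Suc i"] that by (simp add: discrepancy_append)
  qed
  have len: "length (block i) = n" for i by (simp add: block_def)
  have perm: "mset (block i) = mset (block j)" if "i < k" "j < k" for i j
  proof (rule multiset_eqI)
    fix a
    show "count (mset (block i)) a = count (mset (block j)) a"
    proof (cases "a \<in> range u")
      case True
      then have "real (count (mset (block i)) a) = real (count (mset (block j)) a)"
        using disc[OF True that(1)] disc[OF True that(2)] by (simp add: discrepancy_def len)
      then show ?thesis by simp
    next
      case False
      then have "a \<notin> set (block i)" "a \<notin> set (block j)" by (auto simp: block_def)
      then show ?thesis by (simp add: count_mset count_notin)
    qed
  qed
  have concat: "concat (map block [0..<m]) = map u [s + x..<s + x + m * n]" for m
  proof (induction m)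
    case (Suc m)
    have "[s + x..<s + x + Suc m * n] = [s + x..<s + x + m * n] @ [s + (x + m * n)..<s + (x + Suc m * n)]"
      using upt_add_eq_append[of "s + x" "s + x + m * n" n] by (simp add: algebra_simps)
    then show ?case using Suc by (simp add: block_def)
  qed simp
  have "abelian_power k (concat (map block [0..<k]))"
    unfolding abelian_power_def
  proof (intro exI[of _ "map block [0..<k]"] conjI ballI)
    fix v assume v: "v \<in> set (map block [0..<k])"
    then obtain i where i: "i < k" "v = block i" by auto
    then show "v \<noteq> []" using len[of i] assms(2) by auto
    fix v' assume "v' \<in> set (map block [0..<k])"
    then obtain j where "j < k" "v' = block j" by auto
    then show "mset v = mset v'" using perm[OF i(1)] i(2) by simp
  qed simp_all
  moreover have "concat (map block [0..<k]) \<in> language u"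
    unfolding concat language_eq using assms by (intro CollectI exI[of _ "s + x"] exI[of _ "s + x + k * n"]) auto
  ultimately show ?thesis unfolding avoids_abelian_powers_def by blast
qed

section \<open>The sign coloring and the conclusion\<close>

theorem theorem2:
  fixes A :: "'a set" and u :: "'a word" and k0 :: nat
  assumes "finite A"
    and "range u \<subseteq> A"
    and "\<forall>w\<in>language u. has_uniform_frequency u w"
    and "k0 > 0"
    and "avoids_abelian_powers u k0"
  shows "\<exists>r\<ge>1. \<exists>c \<in> language u \<rightarrow> {1..r}.
    \<forall>p>0. \<exists>k1. \<forall>k\<ge>k1. \<forall>w\<in>language u. \<not> monochromatic_power u c k p w"
proof -
  have fin: "finite (range u)" using assms(1,2) finite_subset by blast
  have "\<exists>d. \<forall>e>0. \<exists>L. \<forall>v\<in>language u. length v \<ge> L \<longrightarrow>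
      \<bar>real (count (mset v) a) - d * real (length v)\<bar> \<le> e * real (length v)" if "a \<in> range u" for a
  proof -
    obtain i where "a = u i" using \<open>a \<in> range u\<close> by blast
    then have "[a] = map u [i..<Suc i]" by simp
    then have "[a] \<in> language u" unfolding language_eq by (metis (mono_tags, lifting) CollectI lessI)
    then show ?thesis using discrepancy_uniform_bound assms(3) by metis
  qed
  then obtain d where d: "\<And>a e. a \<in> range u \<Longrightarrow> e > 0 \<Longrightarrow> \<exists>L. \<forall>v\<in>language u. length v \<ge> L \<longrightarrow>
      \<bar>discrepancy d a v\<bar> \<le> e * real (length v)"
    unfolding discrepancy_def by metis
  \<comment> \<open>The possible sign vectors, one entry per letter of \<open>u\<close>;
    extensionality outside \<open>range u\<close> makes this set finite.\<close>
  define S where "S = (range u \<rightarrow>\<^sub>E {-1, 0, 1 :: real})"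
  have "finite S" unfolding S_def using fin by (intro finite_PiE) auto
  then obtain h where h: "bij_betw h S {0..<card S}"
    using ex_bij_betw_finite_nat by blast
  define sg where "sg v = (\<lambda>a\<in>range u. sgn (discrepancy d a v))" for v
  have sg: "sg v \<in> S" for v by (auto simp: sg_def S_def sgn_real_def)
  \<comment> \<open>\<open>Suc\<close> moves the indices from \<open>{0..<card S}\<close> to
    \<open>{1..card S}\<close>.\<close>
  define c where "c v = Suc (h (sg v))" for v
  have c_range: "c v \<in> {1..card S}" for v
    using bij_betwE[OF h] sg[of v] by (auto simp: c_def Suc_le_eq)
  have c_eq: "sgn (discrepancy d a v) = sgn (discrepancy d a v')" if "c v = c v'" "a \<in> range u" for v v' a
  proof -
    have "sg v = sg v'"
      using that(1) h sg by (auto simp: c_def bij_betw_def dest: inj_onD)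
    then show ?thesis using that(2) unfolding sg_def by (metis restrict_apply')
  qed
  have "\<exists>k1. \<forall>k\<ge>k1. \<forall>w\<in>language u. \<not> monochromatic_power u c k p w" for p
  proof -
    have "\<forall>a\<in>range u. \<exists>K. \<forall>ws. length ws \<ge> K \<and> concat ws \<in> language u \<and>
        (\<forall>v\<in>set ws. v \<noteq> [] \<and> length v < p) \<and>
        (\<forall>v\<in>set ws. \<forall>v'\<in>set ws. sgn (discrepancy d a v) = sgn (discrepancy d a v')) \<longrightarrow>
        (\<forall>v\<in>set ws. discrepancy d a v = 0)"
      by (intro ballI discrepancy_vanishes d)
    from bchoice[OF this] obtain K where K: "\<forall>a\<in>range u. \<forall>ws.
        length ws \<ge> K a \<and> concat ws \<in> language u \<and>
        (\<forall>v\<in>set ws. v \<noteq> [] \<and> length v < p) \<and>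
        (\<forall>v\<in>set ws. \<forall>v'\<in>set ws. sgn (discrepancy d a v) = sgn (discrepancy d a v')) \<longrightarrow>
        (\<forall>v\<in>set ws. discrepancy d a v = 0)" ..
    from progression_in_cut_points[of p k0] obtain K' where K': "\<forall>T k.
        K' \<le> k \<and> T 0 = (0::nat) \<and> (\<forall>j<k. T j < T (Suc j) \<and> T (Suc j) < T j + p) \<longrightarrow>
        (\<exists>a d. d > 0 \<and> (\<forall>i\<le>k0. \<exists>j\<le>k. a + i * d = T j))" ..
    show ?thesis
    \<comment> \<open>Finitely many letters allow a common threshold for vanishing discrepancies;
      \<open>K'\<close> secures the progression of cut points.\<close>
    proof (intro exI[of _ "Max (insert K' (K ` range u))"] allI impI ballI notI)
      fix k w
      assume "k \<ge> Max (insert K' (K ` range u))" and w: "w \<in> language u"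
        and "monochromatic_power u c k p w"
      then have k: "k \<ge> K'" "\<And>a. a \<in> range u \<Longrightarrow> k \<ge> K a" using fin by auto
      obtain ws where ws: "length ws = k" "w = concat ws" "set ws \<subseteq> language u"
          "\<And>v v'. v \<in> set ws \<Longrightarrow> v' \<in> set ws \<Longrightarrow> c v = c v'" "\<And>v. v \<in> set ws \<Longrightarrow> length v < p"
        using \<open>monochromatic_power u c k p w\<close> unfolding monochromatic_power_def by blast
      have ne: "v \<noteq> []" if "v \<in> set ws" for v
        using that ws(3) by (auto simp: language_eq)
      have zero: "discrepancy d a v = 0" if "a \<in> range u" "v \<in> set ws" for a v
      proof -
        have "\<forall>v\<in>set ws. discrepancy d a v = 0"
        proof (rule K[THEN bspec, OF that(1), THEN spec, THEN mp], intro conjI)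
          show "length ws \<ge> K a" using k(2) ws(1) that(1) by simp
          show "concat ws \<in> language u" using ws(2) w by simp
          show "\<forall>v\<in>set ws. v \<noteq> [] \<and> length v < p" using ne ws(5) by blast
          show "\<forall>v\<in>set ws. \<forall>v'\<in>set ws. sgn (discrepancy d a v) = sgn (discrepancy d a v')"
            using ws(4) c_eq that(1) by blast
        qed
        then show ?thesis using that(2) by blast
      qed
      define T where "T j = length (concat (take j ws))" for j
      have T_Suc: "T (Suc j) = T j + length (ws ! j)" if "j < k" for j
        using that ws(1) by (simp add: T_def take_Suc_conv_app_nth)
      \<comment> \<open>The \<open>k0 + 1\<close> cut points delimit \<open>k0\<close> consecutive
        stretches of length \<open>n\<close>.\<close>
      have "\<exists>x n. n > 0 \<and> (\<forall>i\<le>k0. \<exists>j\<le>k. x + i * n = T j)"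
      proof (rule K'[rule_format], intro conjI allI impI)
        show "K' \<le> k" by (rule k(1))
        show "T 0 = 0" by (simp add: T_def)
        fix j assume j: "j < k"
        then have "ws ! j \<in> set ws" using ws(1) by simp
        then show "T j < T (Suc j)" "T (Suc j) < T j + p"
          using T_Suc[OF j] ws(5) ne by simp_all
      qed
      then obtain x n where n: "n > 0" and cut: "\<And>i. i \<le> k0 \<Longrightarrow> \<exists>j\<le>k. x + i * n = T j"
        by blast
      obtain s t where st: "w = map u [s..<t]" using w by (auto simp: language_eq)
      \<comment> \<open>A prefix of \<open>w\<close> ending at a cut point consists of whole blocks,
        each of discrepancy 0.\<close>
      have "discrepancy d a (map u [s..<s + (x + i * n)]) = 0" if a: "a \<in> range u" and i: "i \<le> k0" for a i
      proof -
        obtain j where j: "j \<le> k" "x + i * n = T j" using cut[OF i] by blast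
        have w_split: "w = concat (take j ws) @ concat (drop j ws)"
          unfolding ws(2) by (metis append_take_drop_id concat_append)
        then have "concat (take j ws) = take (T j) w" by (simp add: T_def)
        also have "\<dots> = map u [s..<s + T j]"
        proof -
          have "T j \<le> t - s"
            using arg_cong[OF w_split, of length] by (simp add: st T_def)
          \<comment> \<open>For \<open>T j = 0\<close> the truncated \<open>t - s\<close> does not
            yield \<open>s + T j \<le> t\<close>, hence the case split.\<close>
          then show ?thesis
            by (cases "T j = 0") (simp_all add: st take_map)
        qed
        finally have "map u [s..<s + (x + i * n)] = concat (take j ws)" using j by simp
        moreover have "discrepancy d a (concat (take j ws)) = 0"
          unfolding discrepancy_concat using zero[OF a]
          by (intro sum_list_nonneg_eq_0_iff[THEN iffD2]) (auto dest: in_set_takeD)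
        ultimately show ?thesis by simp
      qed
      then have "\<not> avoids_abelian_powers u k0"
        using abelian_power_in_language n assms(4) by blast
      then show False using assms(5) by blast
    qed
  qed
  moreover have "card S \<ge> 1" using c_range[of "[]"] by simp
  ultimately show ?thesis using c_range by (intro exI[of _ "card S"] conjI bexI[of _ c]) auto
qed

end
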